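(* Let $a,b,d\ge 1$ be integers with $\gcd(a,b)=1$, let $B^{+}=(b-1)(a+b)-b(d+1)$, and let $t>da$ be an integer with $\gcd(t,d)=1$. If $t>B^{+}$, then there exists $\mathbf v\in\mathcal O_t^{+}$ with $\ell(\mathbf v)=d$; while if $t=B^{+}$, then every nonzero $\mathbf v\in\mathcal O_t^{+}$ has $\ell(\mathbf v)>d$. In particular, the lower bound $B^{+}$ is optimal (the existence of a length-$d$ element fails at $t=B^{+}$).
   Context: $\mathbb L_t=\{(v_0,v_1,v_2)\in\mathbb Z^3:(t-da)v_0+tv_1+(t+db)v_2=0\}$, and $\mathcal O_t^{+}=\{\mathbf v\in\mathbb L_t : v_0\ge 0,\ v_1\ge 0\}$ (last coordinates are then automatically $\le 0$). The length of $\mathbf v$ is $\ell(\mathbf v)=v_0+v_1+v_2$. *)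

theory Defs
  imports Main
begin

definition lattice_L :: "int \<Rightarrow> int \<Rightarrow> int \<Rightarrow> int \<Rightarrow> (int \<times> int \<times> int) set" where
  "lattice_L a b d t =
     {(v0, v1, v2). (t - d * a) * v0 + t * v1 + (t + d * b) * v2 = 0}"

text \<open>For \<open>a, b, d \<ge> 1\<close> and \<open>t > d * a\<close> the last coordinate of every element is
  automatically \<open>\<le> 0\<close>, so no such condition is imposed.\<close>

definition O_plus :: "int \<Rightarrow> int \<Rightarrow> int \<Rightarrow> int \<Rightarrow> (int \<times> int \<times> int) set" where
  "O_plus a b d t = {(v0, v1, v2) \<in> lattice_L a b d t. v0 \<ge> 0 \<and> v1 \<ge> 0}"

definition vec_length :: "int \<times> int \<times> int \<Rightarrow> int" where
  "vec_length = (\<lambda>(v0, v1, v2). v0 + v1 + v2)"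

definition B_plus :: "int \<Rightarrow> int \<Rightarrow> int \<Rightarrow> int" where
  "B_plus a b d = (b - 1) * (a + b) - b * (d + 1)"

end

theory Submission
  imports Defs
begin

text \<open>The theorem is the Frobenius coin problem for the coprime denominations \<open>a + b\<close> and \<open>b\<close>.
  The equation of the lattice can be regrouped as \<open>t * l = d * (a * v0 - b * v2)\<close>, where \<open>l\<close> is
  the length of the vector. As \<open>t\<close> and \<open>d\<close> are coprime, the length is a multiple \<open>l = d * m\<close>, and
  eliminating \<open>v2\<close> turns the equation into \<open>(t + b * d) * m = (a + b) * v0 + b * v1\<close>
  (\<open>O_plus_iff\<close>). Hence an element of length \<open>d\<close> exists iff \<open>t + b * d\<close> is a non-negative
  combination of \<open>a + b\<close> and \<open>b\<close>. By Sylvester's theorem every integer beyond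
  \<open>(a + b) * b - (a + b) - b\<close> is such a combination and this number itself is not
  (\<open>above_frobenius_representable\<close>, \<open>frobenius_not_representable\<close>); subtracting \<open>b * d\<close> from it
  gives exactly \<open>B_plus\<close>. At \<open>t = B_plus\<close> the multiplier \<open>m = 1\<close> is thus excluded. For a
  nonzero vector \<open>m \<ge> 1\<close>, because \<open>t + b * d > 0\<close>, so the length is at least \<open>2 * d\<close>.\<close>

text \<open>Reducing the Bezout solution modulo \<open>q\<close> makes the first coefficient at most \<open>q - 1\<close>; the
  second one is then larger than \<open>-1\<close>.\<close>

lemma above_frobenius_representable:
  fixes p q n :: int
  assumes "p \<ge> 1" "q \<ge> 1" "coprime p q" "n > p * q - p - q"
  shows "\<exists>x y. x \<ge> 0 \<and> y \<ge> 0 \<and> n = p * x + q * y"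
proof -
  obtain u w where bezout: "u * p + w * q = 1"
    using assms(3) bezout_int[of p q] by auto
  define x where "x = (n * u) mod q"
  have x: "0 \<le> x" "x \<le> q - 1"
    using assms(2) by (simp_all add: x_def)
  have "n - p * x = n * (u * p + w * q) - p * (n * u - q * ((n * u) div q))"
    by (simp only: bezout x_def minus_mult_div_eq_mod mult_1_right)
  also have "\<dots> = q * (n * w + p * ((n * u) div q))"
    by (simp add: algebra_simps)
  finally obtain y where y: "n - p * x = q * y"
    by blast
  have "p * x \<le> p * (q - 1)"
    using x(2) assms(1) by (intro mult_left_mono) auto
  then have "q * (-1) < q * y"
    using y assms(4) by (simp add: algebra_simps)
  then have "y \<ge> 0"
    using assms(2) by (simp only: mult_less_cancel_left) linarith
  moreover have "n = p * x + q * y"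
    using y by simp
  ultimately show ?thesis
    using x(1) by blast
qed

text \<open>A representation would give \<open>p * (x + 1) + q * (y + 1) = p * q\<close>, where coprimality forces
  \<open>q dvd x + 1\<close>; then the first summand alone is already at least \<open>p * q\<close>.\<close>

lemma frobenius_not_representable:
  fixes p q x y :: int
  assumes "p \<ge> 1" "q \<ge> 1" "coprime p q" "x \<ge> 0" "y \<ge> 0"
  shows "p * x + q * y \<noteq> p * q - p - q"
proof
  assume "p * x + q * y = p * q - p - q"
  then have eq: "p * (x + 1) = q * (p - (y + 1))"
    by (simp add: algebra_simps)
  then have "q dvd p * (x + 1)"
    by simp
  then have "q dvd x + 1"
    using assms(3) by (simp add: coprime_dvd_mult_right_iff coprime_commute)
  then have "q \<le> x + 1"
    using assms(4) by (intro zdvd_imp_le) auto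
  then have "p * q \<le> p * (x + 1)"
    using assms(1) by (intro mult_left_mono) auto
  moreover have "q * (y + 1) > 0"
    using assms(2,5) by simp
  ultimately show False
    using eq by (simp add: algebra_simps)
qed

text \<open>The factor \<open>m\<close> exists because \<open>d\<close> divides \<open>t\<close> times the length and is coprime to \<open>t\<close>; the
  equation for \<open>m\<close> no longer involves \<open>v2\<close>, so membership becomes a representation problem with
  non-negative coefficients.\<close>

lemma O_plus_iff:
  fixes a b d t v0 v1 v2 :: int
  assumes "d \<ge> 1" "coprime t d"
  shows "(v0, v1, v2) \<in> O_plus a b d t \<longleftrightarrow>
    v0 \<ge> 0 \<and> v1 \<ge> 0 \<and>
    (\<exists>m. vec_length (v0, v1, v2) = d * m \<and> (t + b * d) * m = (a + b) * v0 + b * v1)"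
proof -
  let ?l = "v0 + v1 + v2"
  have regroup: "(t - d * a) * v0 + t * v1 + (t + d * b) * v2 = t * ?l - d * (a * v0 - b * v2)"
    by (simp add: algebra_simps)
  have "t * ?l = d * (a * v0 - b * v2) \<longleftrightarrow>
    (\<exists>m. ?l = d * m \<and> (t + b * d) * m = (a + b) * v0 + b * v1)" (is "?L \<longleftrightarrow> ?R")
  proof
    assume L: ?L
    then have "d dvd t * ?l"
      by simp
    then have "d dvd ?l"
      using assms(2) by (simp add: coprime_dvd_mult_right_iff coprime_commute)
    then obtain m where m: "?l = d * m"
      by blast
    have "d * (t * m) = d * (a * v0 - b * v2)"
      using L m by (simp add: mult.left_commute)
    then have "t * m = a * v0 - b * v2"
      using assms(1) by simp
    moreover have v2: "v2 = d * m - v0 - v1"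
      using m by simp
    ultimately have "(t + b * d) * m = (a + b) * v0 + b * v1"
      by (simp add: algebra_simps)
    with m show ?R
      by blast
  next
    assume ?R
    then obtain m where m: "?l = d * m" "(t + b * d) * m = (a + b) * v0 + b * v1"
      by blast
    have v2: "v2 = d * m - v0 - v1"
      using m(1) by simp
    have "t * m = a * v0 - b * v2"
      using m(2) by (simp add: v2 algebra_simps)
    then show ?L
      using m(1) by (simp add: mult.left_commute)
  qed
  then show ?thesis
    by (simp add: O_plus_def lattice_L_def vec_length_def regroup conj_commute)
qed

theorem proposition4p2:
  fixes a b d t :: int
  assumes "a \<ge> 1" and "b \<ge> 1" and "d \<ge> 1"
    and "gcd a b = 1"
    and "t > d * a"
    and "gcd t d = 1"
  shows "(t > B_plus a b d \<longrightarrow> (\<exists>v \<in> O_plus a b d t. vec_length v = d))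
       \<and> (t = B_plus a b d \<longrightarrow> (\<forall>v \<in> O_plus a b d t. v \<noteq> (0, 0, 0) \<longrightarrow> vec_length v > d))
       \<and> (t = B_plus a b d \<longrightarrow> \<not> (\<exists>v \<in> O_plus a b d t. vec_length v = d))"
proof -
  have cop: "coprime (a + b) b"
    using assms(4) by (simp add: coprime_iff_gcd_eq_1)
  have cop_td: "coprime t d"
    using assms(6) by (simp add: coprime_iff_gcd_eq_1)
  note O_iff = O_plus_iff[OF assms(3) cop_td]
  have B: "B_plus a b d = (a + b) * b - (a + b) - b - b * d"
    by (simp add: B_plus_def algebra_simps)

  have exists: "\<exists>v \<in> O_plus a b d t. vec_length v = d" if "t > B_plus a b d"
  proof -
    have "t + b * d > (a + b) * b - (a + b) - b"
      using that B by simp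
    then obtain x y where xy: "x \<ge> 0" "y \<ge> 0" "t + b * d = (a + b) * x + b * y"
      using above_frobenius_representable[OF _ assms(2) cop] assms(1,2) by force
    let ?v = "(x, y, d - x - y)"
    have len: "vec_length ?v = d"
      by (simp add: vec_length_def)
    then have "vec_length ?v = d * 1 \<and> (t + b * d) * 1 = (a + b) * x + b * y"
      using xy(3) by simp
    then have "?v \<in> O_plus a b d t"
      unfolding O_iff using xy(1,2) by blast
    with len show ?thesis
      by blast
  qed

  have longer: "vec_length v > d"
    if t: "t = B_plus a b d" and v: "v \<in> O_plus a b d t" "v \<noteq> (0, 0, 0)" for v
  proof -
    obtain v0 v1 v2 where vv: "v = (v0, v1, v2)"
      by (cases v)
    obtain m where nonneg: "v0 \<ge> 0" "v1 \<ge> 0" and len: "vec_length v = d * m"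
      and m: "(t + b * d) * m = (a + b) * v0 + b * v1"
      using v(1) O_iff vv by auto
    have "d * a > 0" "b * d > 0"
      using assms(1-3) by simp_all
    then have pos: "t + b * d > 0"
      using assms(5) by linarith
    have summands: "(a + b) * v0 \<ge> 0" "b * v1 \<ge> 0"
      using nonneg assms(1,2) by simp_all
    then have "m \<ge> 0"
      using m pos by (metis add_nonneg_nonneg linorder_not_less mult_less_cancel_left_pos mult_zero_right)
    moreover have "m \<noteq> 0"
    proof
      assume "m = 0"
      then have "(a + b) * v0 + b * v1 = 0"
        using m by simp
      then have "(a + b) * v0 = 0" "b * v1 = 0"
        using summands by linarith+
      then have "v0 = 0" "v1 = 0"
        using assms(1,2) by simp_all
      then show False
        using len \<open>m = 0\<close> v(2) vv by (simp add: vec_length_def)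
    qed
    moreover have "m \<noteq> 1"
      using frobenius_not_representable[OF _ assms(2) cop nonneg] m t B assms(1,2) by auto
    ultimately have "d * 1 < d * m"
      using assms(3) by simp
    then show ?thesis
      using len by simp
  qed

  have "vec_length (0, 0, 0) \<noteq> d"
    using assms(3) by (simp add: vec_length_def)
  with exists longer show ?thesis
    by (metis less_irrefl)
qed

end
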